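(* Let $X$ be a compact topological space, $f_{1,\infty}=\{f_i\}_{i=1}^\infty$ a sequence of continuous self-maps of $X$, and $Z\subseteq X$ nonempty. Then the maps $\theta\mapsto\underline{h}_{\mathrm{top}}(f_{1,\infty},Z,\theta)$ and $\theta\mapsto\overline{h}_{\mathrm{top}}(f_{1,\infty},Z,\theta)$ (with values in $[0,\infty]$) are continuous for $\theta\in(0,1]$.
   Context: Intermediate topological entropies. Let $X$ be a compact topological space and $f_{1,\infty}=\{f_i\}_{i=1}^\infty$ a sequence of continuous maps $X\to X$. Put $f_i^0=\mathrm{id}_X$ and $f_i^j=f_{i+j-1}\circ\cdots\circ f_{i+1}\circ f_i$ for $j\ge1$. For a finite open cover $\mathcal U$ of $X$ and $m\in\mathbb N=\{1,2,\dots\}$, a string of length $m(\mathbf U)=m$ is an element $\mathbf U=(U_0,\dots,U_{m-1})\in\mathcal S_m(\mathcal U):=\mathcal U^m$, and $X(\mathbf U)=\{x\in X: f_1^j(x)\in U_j,\ 0\le j\le m-1\}$. For $Z\subseteq X$, $\alpha\ge0$, $\theta\in[0,1]$, $N\in\mathbb N$ let \[ M(Z,\alpha,\mathcal U,N,\theta)=\inf_{\mathcal G}\sum_{\mathbf U\in\mathcal G}e^{-\alpha m(\mathbf U)}, \] the infimum over all finite or countable collections $\mathcal G\subseteq\bigcup_{N\le m<N/\theta+1}\mathcal S_m(\mathcal U)$ with $Z\subseteq\bigcup_{\mathbf U\in\mathcal G}X(\mathbf U)$ (for $\theta=0$, $N/\theta=+\infty$). Let $\underline m(Z,\alpha,\mathcal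 U,\theta)=\liminf_{N\to\infty}M(Z,\alpha,\mathcal U,N,\theta)$ and $\overline m(Z,\alpha,\mathcal U,\theta)=\limsup_{N\to\infty}M(Z,\alpha,\mathcal U,N,\theta)$. Set $\underline h_{\mathrm{top}}(f_{1,\infty},Z,\mathcal U,\theta)=\inf\{\alpha\ge0:\underline m(Z,\alpha,\mathcal U,\theta)=0\}$, $\overline h_{\mathrm{top}}(f_{1,\infty},Z,\mathcal U,\theta)=\inf\{\alpha\ge0:\overline m(Z,\alpha,\mathcal U,\theta)=0\}$. The lower and upper $\theta$-intermediate topological entropies $\underline h_{\mathrm{top}}(f_{1,\infty},Z,\theta)$ and $\overline h_{\mathrm{top}}(f_{1,\infty},Z,\theta)$, with values in $[0,\infty]$, are the suprema of these quantities over all finite open covers $\mathcal U$ of $X$. *)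

theory Defs
  imports "HOL-Analysis.Analysis"
begin

text \<open>
  A nonautonomous system on a topological space \<open>X\<close> is a sequence \<open>f\<close> of continuous self-maps;
  as is customary it is indexed from 1, so the value \<open>f 0\<close> is never used.
  \<open>iterate f i j\<close> is the composition \<open>f (i + j - 1) \<circ> \<dots> \<circ> f i\<close> of \<open>j\<close> maps starting at \<open>f i\<close>.
\<close>

primrec iterate :: "(nat \<Rightarrow> 'a \<Rightarrow> 'a) \<Rightarrow> nat \<Rightarrow> nat \<Rightarrow> 'a \<Rightarrow> 'a" where
  "iterate f i 0 = id"
| "iterate f i (Suc j) = f (i + j) \<circ> iterate f i j"

definition finite_open_cover :: "'a topology \<Rightarrow> 'a set set \<Rightarrow> bool" where
  "finite_open_cover X \<U> \<longleftrightarrow> finite \<U> \<and> (\<forall>U\<in>\<U>. openin X U) \<and> \<Union>\<U> = topspace X"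

definition strings :: "nat \<Rightarrow> 'a set set \<Rightarrow> 'a set list set" where
  "strings m \<U> = {Us. length Us = m \<and> set Us \<subseteq> \<U>}"

definition string_set :: "'a topology \<Rightarrow> (nat \<Rightarrow> 'a \<Rightarrow> 'a) \<Rightarrow> 'a set list \<Rightarrow> 'a set" where
  "string_set X f Us = {x \<in> topspace X. \<forall>j<length Us. iterate f 1 j x \<in> Us ! j}"

text \<open>
  The range of string lengths is \<open>N \<le> m < N / \<theta> + 1\<close>.  The case \<open>\<theta> = 0\<close>, where
  \<open>N / \<theta>\<close> means \<open>+\<infinity>\<close>, is separated because division by zero yields 0 in HOL.
\<close>

definition admissible_length :: "nat \<Rightarrow> real \<Rightarrow> nat \<Rightarrow> bool" where
  "admissible_length N \<theta> m \<longleftrightarrow> N \<le> m \<and> (\<theta> = 0 \<or> real m < real N / \<theta> + 1)"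

definition admissible_covers ::
    "'a topology \<Rightarrow> (nat \<Rightarrow> 'a \<Rightarrow> 'a) \<Rightarrow> 'a set \<Rightarrow> 'a set set \<Rightarrow> nat \<Rightarrow> real \<Rightarrow> 'a set list set set" where
  "admissible_covers X f Z \<U> N \<theta> =
     {\<G>. countable \<G> \<and> \<G> \<subseteq> (\<Union>m\<in>{m. admissible_length N \<theta> m}. strings m \<U>) \<and>
          Z \<subseteq> (\<Union>Us\<in>\<G>. string_set X f Us)}"

definition cover_mass ::
    "'a topology \<Rightarrow> (nat \<Rightarrow> 'a \<Rightarrow> 'a) \<Rightarrow> 'a set \<Rightarrow> real \<Rightarrow> 'a set set \<Rightarrow> nat \<Rightarrow> real \<Rightarrow> ennreal" where
  "cover_mass X f Z \<alpha> \<U> N \<theta> =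
     (INF \<G>\<in>admissible_covers X f Z \<U> N \<theta>.
        (\<Sum>\<^sub>\<infinity>Us\<in>\<G>. ennreal (exp (- \<alpha> * real (length Us)))))"

definition lower_mass ::
    "'a topology \<Rightarrow> (nat \<Rightarrow> 'a \<Rightarrow> 'a) \<Rightarrow> 'a set \<Rightarrow> real \<Rightarrow> 'a set set \<Rightarrow> real \<Rightarrow> ennreal" where
  "lower_mass X f Z \<alpha> \<U> \<theta> = liminf (\<lambda>N. cover_mass X f Z \<alpha> \<U> N \<theta>)"

definition upper_mass ::
    "'a topology \<Rightarrow> (nat \<Rightarrow> 'a \<Rightarrow> 'a) \<Rightarrow> 'a set \<Rightarrow> real \<Rightarrow> 'a set set \<Rightarrow> real \<Rightarrow> ennreal" where
  "upper_mass X f Z \<alpha> \<U> \<theta> = limsup (\<lambda>N. cover_mass X f Z \<alpha> \<U> N \<theta>)"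

text \<open>In \<^typ>\<open>ennreal\<close> the infimum of the empty set is \<open>\<infinity>\<close>.\<close>

definition lower_entropy_cover ::
    "'a topology \<Rightarrow> (nat \<Rightarrow> 'a \<Rightarrow> 'a) \<Rightarrow> 'a set \<Rightarrow> 'a set set \<Rightarrow> real \<Rightarrow> ennreal" where
  "lower_entropy_cover X f Z \<U> \<theta> =
     (INF \<alpha>\<in>{\<alpha>. 0 \<le> \<alpha> \<and> lower_mass X f Z \<alpha> \<U> \<theta> = 0}. ennreal \<alpha>)"

definition upper_entropy_cover ::
    "'a topology \<Rightarrow> (nat \<Rightarrow> 'a \<Rightarrow> 'a) \<Rightarrow> 'a set \<Rightarrow> 'a set set \<Rightarrow> real \<Rightarrow> ennreal" where
  "upper_entropy_cover X f Z \<U> \<theta> =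
     (INF \<alpha>\<in>{\<alpha>. 0 \<le> \<alpha> \<and> upper_mass X f Z \<alpha> \<U> \<theta> = 0}. ennreal \<alpha>)"

definition lower_intermediate_entropy ::
    "'a topology \<Rightarrow> (nat \<Rightarrow> 'a \<Rightarrow> 'a) \<Rightarrow> 'a set \<Rightarrow> real \<Rightarrow> ennreal" where
  "lower_intermediate_entropy X f Z \<theta> =
     (SUP \<U>\<in>{\<U>. finite_open_cover X \<U>}. lower_entropy_cover X f Z \<U> \<theta>)"

definition upper_intermediate_entropy ::
    "'a topology \<Rightarrow> (nat \<Rightarrow> 'a \<Rightarrow> 'a) \<Rightarrow> 'a set \<Rightarrow> real \<Rightarrow> ennreal" where
  "upper_intermediate_entropy X f Z \<theta> =
     (SUP \<U>\<in>{\<U>. finite_open_cover X \<U>}. upper_entropy_cover X f Z \<U> \<theta>)"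

end

theory Submission
  imports Defs
begin

text \<open>
  For \<open>0 < s \<le> t \<le> 1\<close> and a fixed cover the entropies satisfy \<open>h s \<le> h t\<close> and
  \<open>(s / t) * h t \<le> h s\<close>; both bounds survive the supremum over covers and squeeze \<open>h\<close> at every
  point of \<open>(0, 1]\<close>, also where the value is \<open>\<infinity>\<close>.  The second bound comes from cutting the strings
  longer than \<open>\<lceil>N / t\<rceil>\<close> down to that length, which enlarges the sets they describe.  A string of
  length \<open>m < N / s + 1\<close> that is cut satisfies \<open>(\<alpha> * t / s) * \<lceil>N / t\<rceil> \<ge> \<alpha> * N / s \<ge> \<alpha> * (m - 1)\<close>,
  so its weight for the exponent \<open>\<alpha> * t / s\<close> is at most \<open>exp \<alpha>\<close> times its old weight for \<open>\<alpha>\<close>.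
\<close>

text \<open>Truncation may send different strings to the same one, so \<open>g\<close> is not
  assumed injective. A finite part of the image has a finite preimage with the same image, and
  merging its points only drops nonnegative terms.\<close>

lemma infsum_image_le_ennreal:
  fixes w :: "'b \<Rightarrow> ennreal"
  assumes le: "\<And>x. x \<in> A \<Longrightarrow> w (g x) \<le> c * v x"
  shows "(\<Sum>\<^sub>\<infinity>y\<in>g ` A. w y) \<le> c * (\<Sum>\<^sub>\<infinity>x\<in>A. v x)"
proof (rule infsum_le_finite_sums)
  fix F assume "finite F" "F \<subseteq> g ` A"
  then obtain C where C: "C \<subseteq> A" "finite C" "F = g ` C"
    by (meson finite_subset_image)
  have "sum w F \<le> (\<Sum>x\<in>C. w (g x))"
    unfolding C(3) using sum_image_le[OF C(2), of w g] by simp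
  also have "\<dots> \<le> (\<Sum>x\<in>C. c * v x)"
    using C le by (intro sum_mono) auto
  also have "\<dots> = c * sum v C"
    by (simp add: sum_distrib_left)
  also have "\<dots> \<le> c * infsum v A"
    using C by (subst nonneg_infsum_complete) (auto intro!: mult_left_mono SUP_upper)
  finally show "sum w F \<le> c * infsum v A" .
qed (simp add: nonneg_summable_on_complete)

lemma string_set_take: "string_set X f Us \<subseteq> string_set X f (take n Us)"
  by (auto simp: string_set_def)

lemma strings_take: "Us \<in> strings m \<U> \<Longrightarrow> take n Us \<in> strings (min m n) \<U>"
  using set_take_subset[of n Us] by (auto simp: strings_def)

lemma admissible_length_antimono:
  assumes "0 < s" "s \<le> t" "admissible_length N t m"
  shows "admissible_length N s m"
proof -
  have "real N / t \<le> real N / s"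
    using assms by (intro divide_left_mono) auto
  then show ?thesis
    using assms by (auto simp: admissible_length_def)
qed

text \<open>A smaller parameter admits more lengths, so the infimum runs over more covers.\<close>

lemma cover_mass_mono:
  assumes "0 < s" "s \<le> t"
  shows "cover_mass X f Z \<alpha> \<U> N s \<le> cover_mass X f Z \<alpha> \<U> N t"
  unfolding cover_mass_def
proof (rule INF_superset_mono)
  show "admissible_covers X f Z \<U> N t \<subseteq> admissible_covers X f Z \<U> N s"
    using admissible_length_antimono[OF assms] by (fastforce simp: admissible_covers_def)
qed simp

lemma cover_mass_scaled_le:
  assumes st: "0 < s" "s \<le> t" "t \<le> 1" and \<alpha>: "0 \<le> \<alpha>"
  shows "ennreal (exp (- \<alpha>)) * cover_mass X f Z (\<alpha> * t / s) \<U> N t \<le> cover_mass X f Z \<alpha> \<U> N s"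
proof -
  define k where "k = nat \<lceil>real N / t\<rceil>"
  have k_ge: "real N / t \<le> real k" and k_less: "real k < real N / t + 1"
    unfolding k_def using st by (auto simp: ceiling_less_iff) linarith+
  \<comment> \<open>Here \<open>t \<le> 1\<close> enters: it keeps the cut length \<open>k\<close>
    from falling below the minimal length \<open>N\<close>.\<close>
  have "real N \<le> real N / t"
    using st by (simp add: field_simps mult_left_le_one_le)
  then have "N \<le> k"
    using k_ge by linarith
  have adm: "admissible_length N t (min m k)" if "admissible_length N s m" for m
    using that st k_less \<open>N \<le> k\<close> by (auto simp: admissible_length_def min_def)
  have weight: "\<alpha> * real m - \<alpha> \<le> \<alpha> * t / s * real (min m k)" if "admissible_length N s m" for m
  proof (cases "m \<le> k")
    case True
    \<comment> \<open>An uncut string only loses weight, since the exponent grows by the factor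
      \<open>t / s \<ge> 1\<close>.\<close>
    have "\<alpha> * real m * 1 \<le> \<alpha> * real m * (t / s)"
      using st \<alpha> by (intro mult_left_mono) auto
    then show ?thesis
      using True \<alpha> by (simp add: mult_ac)
  next
    case False
    \<comment> \<open>The \<open>+ 1\<close> in the upper bound for lengths is what costs the
      summand \<open>\<alpha>\<close>, hence the factor \<open>exp \<alpha>\<close> below. It does
      not depend on \<open>N\<close>.\<close>
    have "\<alpha> * (real m - 1) \<le> \<alpha> * (real N / s)"
      using that st \<alpha> by (intro mult_left_mono) (auto simp: admissible_length_def)
    also have "\<dots> = \<alpha> * t / s * (real N / t)"
      using st by simp
    also have "\<dots> \<le> \<alpha> * t / s * real k"
      using st \<alpha> by (intro mult_left_mono k_ge) auto
    finally show ?thesis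
      using False by (simp add: algebra_simps)
  qed
  show ?thesis
    unfolding cover_mass_def[of _ _ _ \<alpha>]
  proof (rule INF_greatest)
    fix \<G> assume \<G>: "\<G> \<in> admissible_covers X f Z \<U> N s"
    have len: "admissible_length N s (length Us)" "Us \<in> strings (length Us) \<U>" if "Us \<in> \<G>" for Us
      using \<G> that by (fastforce simp: admissible_covers_def strings_def)+
    have "countable (take k ` \<G>)"
      using \<G> by (simp add: admissible_covers_def)
    moreover have "take k ` \<G> \<subseteq> (\<Union>m\<in>{m. admissible_length N t m}. strings m \<U>)"
      using strings_take[OF len(2), of _ k] adm[OF len(1)] by blast
    moreover have "Z \<subseteq> (\<Union>Us\<in>take k ` \<G>. string_set X f Us)"
      using \<G> string_set_take[of X f _ k] by (fastforce simp: admissible_covers_def)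
    ultimately have "take k ` \<G> \<in> admissible_covers X f Z \<U> N t"
      by (simp add: admissible_covers_def)
    then have "cover_mass X f Z (\<alpha> * t / s) \<U> N t
        \<le> (\<Sum>\<^sub>\<infinity>Us\<in>take k ` \<G>. ennreal (exp (- (\<alpha> * t / s) * real (length Us))))"
      unfolding cover_mass_def by (rule INF_lower)
    also have "\<dots> \<le> ennreal (exp \<alpha>) * (\<Sum>\<^sub>\<infinity>Us\<in>\<G>. ennreal (exp (- \<alpha> * real (length Us))))"
    proof (rule infsum_image_le_ennreal)
      fix Us assume "Us \<in> \<G>"
      then have "- (\<alpha> * t / s) * real (length (take k Us)) \<le> \<alpha> + - \<alpha> * real (length Us)"
        using weight[OF len(1), of Us] by simp
      then show "ennreal (exp (- (\<alpha> * t / s) * real (length (take k Us))))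
          \<le> ennreal (exp \<alpha>) * ennreal (exp (- \<alpha> * real (length Us)))"
        by (simp only: ennreal_mult[symmetric] exp_add[symmetric] exp_ge_zero exp_le_cancel_iff ennreal_leI)
    qed
    finally have "ennreal (exp (- \<alpha>)) * cover_mass X f Z (\<alpha> * t / s) \<U> N t
        \<le> ennreal (exp (- \<alpha>)) * (ennreal (exp \<alpha>) * (\<Sum>\<^sub>\<infinity>Us\<in>\<G>. ennreal (exp (- \<alpha> * real (length Us)))))"
      by (rule mult_left_mono) simp
    also have "\<dots> = (\<Sum>\<^sub>\<infinity>Us\<in>\<G>. ennreal (exp (- \<alpha> * real (length Us))))"
      by (simp add: mult.assoc[symmetric] ennreal_mult[symmetric] exp_add[symmetric])
    finally show "ennreal (exp (- \<alpha>)) * cover_mass X f Z (\<alpha> * t / s) \<U> N t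
        \<le> (\<Sum>\<^sub>\<infinity>Us\<in>\<G>. ennreal (exp (- \<alpha> * real (length Us))))" .
  qed
qed

text \<open>Multiplication by a finite constant is monotone and continuous on
  \<open>ennreal\<close>, so it commutes with \<open>liminf\<close>; as \<open>c\<close> is
  positive, it can then be cancelled.\<close>

lemma Liminf_eq_0_cmult_ennreal:
  fixes u v :: "nat \<Rightarrow> ennreal"
  assumes "0 < c" "\<And>n. ennreal c * u n \<le> v n" "liminf v = 0"
  shows "liminf u = 0"
proof -
  have "ennreal c * liminf u = liminf (\<lambda>n. ennreal c * u n)"
    by (rule Liminf_compose_continuous_mono[symmetric])
       (auto intro!: monoI mult_left_mono ennreal_tendsto_cmult simp: continuous_on_def)
  also have "\<dots> \<le> liminf v"
    using assms by (intro Liminf_mono) auto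
  finally show ?thesis
    using assms by simp
qed

lemma Limsup_eq_0_cmult_ennreal:
  fixes u v :: "nat \<Rightarrow> ennreal"
  assumes "0 < c" "\<And>n. ennreal c * u n \<le> v n" "limsup v = 0"
  shows "limsup u = 0"
proof -
  have "ennreal c * limsup u = limsup (\<lambda>n. ennreal c * u n)"
    by (rule Limsup_compose_continuous_mono[symmetric])
       (auto intro!: monoI mult_left_mono ennreal_tendsto_cmult simp: continuous_on_def)
  also have "\<dots> \<le> limsup v"
    using assms by (intro Limsup_mono) auto
  finally show ?thesis
    using assms by simp
qed

text \<open>Each exponent for \<open>P\<close> yields the competitor \<open>\<alpha> * t / s\<close>
  for \<open>Q\<close>, and the factor \<open>s / t\<close> undoes the scaling. If \<open>P\<close>
  has no exponent, the right-hand side is infinite.\<close>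

lemma INF_zero_set_scaled_le:
  fixes P Q :: "real \<Rightarrow> bool"
  assumes "0 < s" "0 < t" and imp: "\<And>\<alpha>. 0 \<le> \<alpha> \<Longrightarrow> P \<alpha> \<Longrightarrow> Q (\<alpha> * t / s)"
  shows "ennreal (s / t) * (INF \<alpha>\<in>{\<alpha>. 0 \<le> \<alpha> \<and> Q \<alpha>}. ennreal \<alpha>) \<le> (INF \<alpha>\<in>{\<alpha>. 0 \<le> \<alpha> \<and> P \<alpha>}. ennreal \<alpha>)"
proof (rule INF_greatest)
  fix \<alpha> assume "\<alpha> \<in> {\<alpha>. 0 \<le> \<alpha> \<and> P \<alpha>}"
  then have "ennreal (s / t) * (INF \<alpha>\<in>{\<alpha>. 0 \<le> \<alpha> \<and> Q \<alpha>}. ennreal \<alpha>) \<le> ennreal (s / t) * ennreal (\<alpha> * t / s)"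
    using assms by (intro mult_left_mono INF_lower) auto
  also have "\<dots> = ennreal \<alpha>"
    using assms \<open>\<alpha> \<in> _\<close> by (simp add: ennreal_mult[symmetric])
  finally show "ennreal (s / t) * (INF \<alpha>\<in>{\<alpha>. 0 \<le> \<alpha> \<and> Q \<alpha>}. ennreal \<alpha>) \<le> ennreal \<alpha>" .
qed

lemma lower_entropy_cover_mono:
  assumes "0 < s" "s \<le> t"
  shows "lower_entropy_cover X f Z \<U> s \<le> lower_entropy_cover X f Z \<U> t"
  unfolding lower_entropy_cover_def
proof (rule INF_superset_mono)
  have "lower_mass X f Z \<alpha> \<U> s \<le> lower_mass X f Z \<alpha> \<U> t" for \<alpha>
    unfolding lower_mass_def by (intro Liminf_mono always_eventually allI cover_mass_mono assms)
  then show "{\<alpha>. 0 \<le> \<alpha> \<and> lower_mass X f Z \<alpha> \<U> t = 0} \<subseteq> {\<alpha>. 0 \<le> \<alpha> \<and> lower_mass X f Z \<alpha> \<U> s = 0}"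
    by (metis (mono_tags, lifting) Collect_mono le_zero_eq)
qed simp

lemma upper_entropy_cover_mono:
  assumes "0 < s" "s \<le> t"
  shows "upper_entropy_cover X f Z \<U> s \<le> upper_entropy_cover X f Z \<U> t"
  unfolding upper_entropy_cover_def
proof (rule INF_superset_mono)
  have "upper_mass X f Z \<alpha> \<U> s \<le> upper_mass X f Z \<alpha> \<U> t" for \<alpha>
    unfolding upper_mass_def by (intro Limsup_mono always_eventually allI cover_mass_mono assms)
  then show "{\<alpha>. 0 \<le> \<alpha> \<and> upper_mass X f Z \<alpha> \<U> t = 0} \<subseteq> {\<alpha>. 0 \<le> \<alpha> \<and> upper_mass X f Z \<alpha> \<U> s = 0}"
    by (metis (mono_tags, lifting) Collect_mono le_zero_eq)
qed simp

lemma lower_entropy_cover_scaled_le: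
  assumes "0 < s" "s \<le> t" "t \<le> 1"
  shows "ennreal (s / t) * lower_entropy_cover X f Z \<U> t \<le> lower_entropy_cover X f Z \<U> s"
  unfolding lower_entropy_cover_def lower_mass_def
  using assms
  by (intro INF_zero_set_scaled_le Liminf_eq_0_cmult_ennreal[OF exp_gt_zero cover_mass_scaled_le]) auto

lemma upper_entropy_cover_scaled_le:
  assumes "0 < s" "s \<le> t" "t \<le> 1"
  shows "ennreal (s / t) * upper_entropy_cover X f Z \<U> t \<le> upper_entropy_cover X f Z \<U> s"
  unfolding upper_entropy_cover_def upper_mass_def
  using assms
  by (intro INF_zero_set_scaled_le Limsup_eq_0_cmult_ennreal[OF exp_gt_zero cover_mass_scaled_le]) auto

text \<open>Neither bound has a constant depending on \<open>i\<close>, so both pass to the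
  supremum, which need not be finite. Near \<open>t\<close> they trap it between multiples of its
  value at \<open>t\<close> whose factors tend to 1.\<close>

lemma continuous_on_SUP_ratio_bounded_ennreal:
  fixes h :: "'c \<Rightarrow> real \<Rightarrow> ennreal"
  assumes mono: "\<And>i s t. 0 < s \<Longrightarrow> s \<le> t \<Longrightarrow> h i s \<le> h i t"
    and ratio: "\<And>i s t. 0 < s \<Longrightarrow> s \<le> t \<Longrightarrow> t \<le> 1 \<Longrightarrow> ennreal (s / t) * h i t \<le> h i s"
  shows "continuous_on {0<..1} (\<lambda>t. SUP i\<in>I. h i t)"
  unfolding continuous_on_def
proof
  fix t :: real assume t: "t \<in> {0<..1}"
  define g where "g = (\<lambda>t. SUP i\<in>I. h i t)"
  have g_mono: "g s \<le> g t" if "0 < s" "s \<le> t" for s t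
    unfolding g_def using that by (intro SUP_mono' mono)
  have g_ratio: "ennreal (s / t) * g t \<le> g s" if "0 < s" "s \<le> t" "t \<le> 1" for s t
    unfolding g_def SUP_mult_left_ennreal using that by (intro SUP_mono' ratio)
  \<comment> \<open>The \<open>min\<close> here and the \<open>max\<close> below merge the cases
    \<open>s \<le> t\<close> and \<open>t \<le> s\<close>, giving one two-sided squeeze.\<close>
  have lower: "ennreal (min 1 (s / t)) * g t \<le> g s" if "s \<in> {0<..1}" for s
    using that t g_ratio[of s t] g_mono[of t s] by (cases "s \<le> t") (auto simp: min_def)
  have upper: "g s \<le> ennreal (max 1 (s / t)) * g t" if s: "s \<in> {0<..1}" for s
  proof (cases "s \<le> t")
    case True
    then show ?thesis using s t g_mono[of s t] by (auto simp: max_def)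
  next
    case False
    \<comment> \<open>The ratio bound with \<open>s\<close> and \<open>t\<close> exchanged,
      multiplied by \<open>s / t\<close> to isolate \<open>g s\<close> without dividing in
      \<open>ennreal\<close>.\<close>
    then have "ennreal (s / t) * (ennreal (t / s) * g s) \<le> ennreal (s / t) * g t"
      using s t by (intro mult_left_mono g_ratio) auto
    moreover have "ennreal (s / t) * (ennreal (t / s) * g s) = g s"
      using s t by (simp add: mult.assoc[symmetric] ennreal_mult[symmetric])
    ultimately show ?thesis using False t by (auto simp: max_def)
  qed
  \<comment> \<open>Multiplication on \<open>ennreal\<close> is discontinuous only at zero times
    infinity. The limit factor is 1, so an infinite \<open>g t\<close> is allowed.\<close>
  have "((\<lambda>s. ennreal (c s) * g t) \<longlongrightarrow> ennreal 1 * g t) (at t within {0<..1})"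
    if "(c \<longlongrightarrow> 1) (at t within {0<..1})" for c
    using that by (intro tendsto_mult_ennreal tendsto_ennrealI tendsto_const) auto
  then have lims: "((\<lambda>s. ennreal (c s) * g t) \<longlongrightarrow> g t) (at t within {0<..1})"
    if "(c \<longlongrightarrow> 1) (at t within {0<..1})" for c
    using that by simp
  have "((\<lambda>s. min 1 (s / t)) \<longlongrightarrow> min 1 (t / t)) (at t within {0<..1})"
    using t by (intro tendsto_intros) simp
  then have lim_min: "((\<lambda>s. min 1 (s / t)) \<longlongrightarrow> 1) (at t within {0<..1})"
    using t by simp
  have "((\<lambda>s. max 1 (s / t)) \<longlongrightarrow> max 1 (t / t)) (at t within {0<..1})"
    using t by (intro tendsto_intros) simp
  then have lim_max: "((\<lambda>s. max 1 (s / t)) \<longlongrightarrow> 1) (at t within {0<..1})"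
    using t by simp
  have "(g \<longlongrightarrow> g t) (at t within {0<..1})"
    by (rule tendsto_sandwich[OF _ _ lims[OF lim_min] lims[OF lim_max]])
       (auto simp: eventually_at_filter intro!: always_eventually lower upper)
  then show "((\<lambda>t. SUP i\<in>I. h i t) \<longlongrightarrow> (SUP i\<in>I. h i t)) (at t within {0<..1})"
    by (simp add: g_def)
qed

theorem corollary2p9:
  fixes X :: "'a topology" and f :: "nat \<Rightarrow> 'a \<Rightarrow> 'a" and Z :: "'a set"
  assumes "compact_space X"
    and "\<And>i. 1 \<le> i \<Longrightarrow> continuous_map X X (f i)"
    and "Z \<subseteq> topspace X" and "Z \<noteq> {}"
  shows "continuous_on {0<..1} (\<lambda>\<theta>::real. lower_intermediate_entropy X f Z \<theta>) \<and>
         continuous_on {0<..1} (\<lambda>\<theta>::real. upper_intermediate_entropy X f Z \<theta>)"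
  unfolding lower_intermediate_entropy_def upper_intermediate_entropy_def
  by (intro conjI continuous_on_SUP_ratio_bounded_ennreal
      lower_entropy_cover_mono lower_entropy_cover_scaled_le
      upper_entropy_cover_mono upper_entropy_cover_scaled_le)

end
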